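(* Let $r$ be a positive integer. For $n\ge 0$ let $\sigma_{rc}\mathrm{mex}(n)=\sum_{\pi}\mathrm{rc\text{-}mex}(\pi)$, the sum over all partitions $\pi$ of $n$ of the $r$-chain mex of $\pi$. Then, for $|q|<1$, $$\sum_{n=0}^{\infty}\sigma_{rc}\mathrm{mex}(n)q^n=-\frac{r-1}{(q;q)_\infty}+\frac{(q^{r+1};q^{r+1})_\infty}{(q;q)_\infty}\sum_{m=1}^{r}\frac{1}{(q^m;q^{r+1})_\infty}.$$
   Context: A partition of $n$ is a non-increasing sequence of positive integers summing to $n$ (the empty partition is the unique partition of $0$). The $r$-chain mex $\mathrm{rc\text{-}mex}(\pi)$ of a partition $\pi$ is the least positive integer $k$ such that none of $k,k+1,\dots,k+r-1$ occurs as a part of $\pi$. For $a\in\mathbb{C}$, $(a;q)_\infty=\prod_{k\ge0}(1-aq^k)$. *)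

theory Defs
  imports "HOL-Analysis.Analysis"
begin

definition partitions :: "nat \<Rightarrow> nat list set" where
  "partitions n = {\<pi>. sorted_wrt (\<ge>) \<pi> \<and> (\<forall>p \<in> set \<pi>. p > 0) \<and> sum_list \<pi> = n}"

definition rc_mex :: "nat \<Rightarrow> nat list \<Rightarrow> nat" where
  "rc_mex r \<pi> = (LEAST k. k > 0 \<and> (\<forall>i<r. k + i \<notin> set \<pi>))"

definition sigma_rc_mex :: "nat \<Rightarrow> nat \<Rightarrow> nat" where
  "sigma_rc_mex r n = (\<Sum>\<pi> \<in> partitions n. rc_mex r \<pi>)"

(* (a;q)_inf; the infinite product converges whenever norm q < 1. *)
definition qpoch_inf :: "complex \<Rightarrow> complex \<Rightarrow> complex" where
  "qpoch_inf a q = (\<Prod>k. 1 - a * q ^ k)"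

(* The sum in sigma_rc_mex ranges over a finite set, and the minimum in rc_mex is attained. *)
lemma finite_partitions: "finite (partitions n)"
proof (rule finite_subset)
  have len: "length xs \<le> sum_list xs" if "\<forall>p \<in> set xs. p > 0" for xs :: "nat list"
    using that by (induction xs) auto
  show "partitions n \<subseteq> {xs. set xs \<subseteq> {..n} \<and> length xs \<le> n}"
    using len by (auto simp: partitions_def intro: member_le_sum_list)
  show "finite {xs. set xs \<subseteq> {..n} \<and> length xs \<le> n}"
    by (rule finite_lists_length_le) simp
qed

lemma rc_mex_least:
  shows "rc_mex r \<pi> > 0" and "\<forall>i<r. rc_mex r \<pi> + i \<notin> set \<pi>"
    and "\<lbrakk>k > 0; \<forall>i<r. k + i \<notin> set \<pi>\<rbrakk> \<Longrightarrow> rc_mex r \<pi> \<le> k"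
proof -
  have "Suc (sum_list \<pi>) + i \<notin> set \<pi>" for i
    using member_le_sum_list[of "Suc (sum_list \<pi>) + i" \<pi>] by auto
  then have ex: "Suc (sum_list \<pi>) > 0 \<and> (\<forall>i<r. Suc (sum_list \<pi>) + i \<notin> set \<pi>)"
    by blast
  show "rc_mex r \<pi> > 0" "\<forall>i<r. rc_mex r \<pi> + i \<notin> set \<pi>"
    using LeastI[of "\<lambda>k. k > 0 \<and> (\<forall>i<r. k + i \<notin> set \<pi>)", OF ex]
    unfolding rc_mex_def by blast+
  show "\<lbrakk>k > 0; \<forall>i<r. k + i \<notin> set \<pi>\<rbrakk> \<Longrightarrow> rc_mex r \<pi> \<le> k"
    unfolding rc_mex_def by (rule Least_le) blast
qed

end

theory Submission
  imports Defs
begin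

text \<open>
  Since \<open>rc_mex r \<pi> > k\<close> means that no \<open>r\<close> consecutive integers in \<open>{1..k + r - 1}\<close> are missing
  from \<open>\<pi>\<close>, the series is the sum over \<open>N \<ge> r - 1\<close> of the generating functions of the partitions
  without a run of \<open>r\<close> missing integers in \<open>{1..N}\<close>. Such a generating function is
  \<open>C N / (q\<^bsup>N+1\<^esup>; q)\<^sub>\<infinity>\<close>, where \<open>C N\<close> counts only partitions with parts at most \<open>N\<close>, and the
  missing terms \<open>N < r - 1\<close> are all \<open>1 / (q; q)\<^sub>\<infinity>\<close>. If \<open>T N\<close> counts those partitions in \<open>C N\<close> that
  contain \<open>N\<close>, then \<open>C N = T N + \<dots> + T (N - r + 1)\<close> and \<open>(1 - q\<^sup>N) T N = q\<^sup>N C (N - 1)\<close>. Hence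
  \<open>T z = (\<Sum>N. T N z\<^sup>N)\<close> satisfies \<open>(1 - q z) T z = (1 - (q z)\<^bsup>r+1\<^esup>) T (q z)\<close>, which determines it at
  all powers of \<open>q\<close>. Expanding \<open>1 / (q\<^bsup>N+1\<^esup>; q)\<^sub>\<infinity>\<close> by Euler's identity and exchanging summations
  leaves \<open>\<Sum>j. q\<^bsup>jm\<^esup> / (q\<^bsup>r+1\<^esup>; q\<^bsup>r+1\<^esup>)\<^sub>j\<close> for \<open>m = 1, \<dots>, r\<close>, summed by Euler's identity again.
\<close>

subsection \<open>Partitions without long gaps\<close>

definition bounded_parts :: "nat \<Rightarrow> nat list set" where
  "bounded_parts L = {\<pi>. sorted_wrt (\<ge>) \<pi> \<and> set \<pi> \<subseteq> {0<..L}}"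

definition all_parts :: "nat list set" where
  "all_parts = {\<pi>. sorted_wrt (\<ge>) \<pi> \<and> (\<forall>p\<in>set \<pi>. p > 0)}"

text \<open>\<open>k + r \<le> Suc N\<close> says, without truncated subtraction, that the window
  from \<open>k\<close> to \<open>k + r - 1\<close> ends at \<open>N\<close> or earlier. For
  \<open>N < r\<close> no window fits and the condition is vacuous.\<close>

definition gapless :: "nat \<Rightarrow> nat \<Rightarrow> nat list \<Rightarrow> bool" where
  "gapless r N \<pi> \<longleftrightarrow> (\<forall>k>0. k + r \<le> Suc N \<longrightarrow> (\<exists>i<r. k + i \<in> set \<pi>))"

definition gapless_all :: "nat \<Rightarrow> nat \<Rightarrow> nat list set" where
  "gapless_all r N = {\<pi> \<in> all_parts. gapless r N \<pi>}"

definition gapless_bounded :: "nat \<Rightarrow> nat \<Rightarrow> nat \<Rightarrow> nat list set" where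
  "gapless_bounded r N L = {\<pi> \<in> bounded_parts L. gapless r N \<pi>}"

text \<open>For \<open>N = 0\<close> the imaginary part \<open>0\<close> counts as present, so that \<open>gapless_max r 0 = {[]}\<close>.\<close>

definition gapless_max :: "nat \<Rightarrow> nat \<Rightarrow> nat list set" where
  "gapless_max r N = {\<pi> \<in> bounded_parts N. gapless r N \<pi> \<and> (N = 0 \<or> N \<in> set \<pi>)}"

text \<open>The windows of length \<open>r\<close> that start at 1, ..., \<open>k\<close> are
  exactly those inside {1..k + r - 1}.\<close>

lemma less_rc_mex_iff:
  assumes "r > 0"
  shows "k < rc_mex r \<pi> \<longleftrightarrow> gapless r (k + r - 1) \<pi>"
proof -
  have "k < rc_mex r \<pi> \<longleftrightarrow> (\<forall>j>0. j \<le> k \<longrightarrow> (\<exists>i<r. j + i \<in> set \<pi>))"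
    using rc_mex_least(1,2)[of r \<pi>] rc_mex_least(3)[of _ r \<pi>]
    by (meson leD leI le_trans less_le_trans)
  also have "\<dots> \<longleftrightarrow> gapless r (k + r - 1) \<pi>"
    using assms by (auto simp: gapless_def)
  finally show ?thesis .
qed

lemma bounded_parts_0: "bounded_parts 0 = {[]}"
  by (auto simp: bounded_parts_def)

lemma bounded_parts_mono: "L \<le> M \<Longrightarrow> bounded_parts L \<subseteq> bounded_parts M"
  by (force simp: bounded_parts_def)

lemma all_parts_eq_Union: "all_parts = (\<Union>L. bounded_parts L)"
proof -
  have "\<pi> \<in> bounded_parts (sum_list \<pi>)" if "\<pi> \<in> all_parts" for \<pi>
    using that member_le_sum_list[of _ \<pi>] by (auto simp: all_parts_def bounded_parts_def)
  then show ?thesis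
    by (auto simp: all_parts_def bounded_parts_def)
qed

text \<open>Only one copy of the largest part is removed. More copies may remain in
  \<open>\<rho>\<close>, and this self-reference produces the geometric factors 1 / (1 -
  q^(L+1)).\<close>

lemma bounded_parts_Suc_iff:
  "\<pi> \<in> bounded_parts (Suc L) \<longleftrightarrow>
     \<pi> \<in> bounded_parts L \<or> (\<exists>\<rho>\<in>bounded_parts (Suc L). \<pi> = Suc L # \<rho>)"
proof (cases \<pi>)
  case Nil
  then show ?thesis by (simp add: bounded_parts_def)
next
  case (Cons p \<rho>)
  show ?thesis
  proof (cases "p = Suc L")
    case True
    then show ?thesis using Cons by (auto simp: bounded_parts_def)
  next
    case False
    then have "\<pi> \<in> bounded_parts (Suc L) \<longleftrightarrow> \<pi> \<in> bounded_parts L"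
      using Cons by (force simp: bounded_parts_def)
    then show ?thesis using Cons False by blast
  qed
qed

lemma Suc_in_bounded_parts_iff:
  assumes "\<pi> \<in> bounded_parts (Suc L)"
  shows "Suc L \<in> set \<pi> \<longleftrightarrow> \<pi> \<notin> bounded_parts L"
proof -
  have "{0<..Suc L} = insert (Suc L) {0<..L}"
    by auto
  then show ?thesis
    using assms by (auto simp: bounded_parts_def)
qed

text \<open>A part above \<open>N\<close> lies in no window inside {1..N}, so adding or removing it
  leaves \<open>gapless r N\<close> unchanged.\<close>

lemma gapless_bounded_Suc:
  assumes "N \<le> L"
  shows "gapless_bounded r N (Suc L) =
    gapless_bounded r N L \<union> (#) (Suc L) ` gapless_bounded r N (Suc L)"
proof -
  have "gapless r N (Suc L # \<rho>) \<longleftrightarrow> gapless r N \<rho>" for \<rho>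
  proof -
    have "k + i \<in> set (Suc L # \<rho>) \<longleftrightarrow> k + i \<in> set \<rho>" if "k + r \<le> Suc N" "i < r" for k i
      using that assms by auto
    then show ?thesis
      unfolding gapless_def by blast
  qed
  then show ?thesis
    using bounded_parts_Suc_iff[of _ L] unfolding gapless_bounded_def by blast
qed

lemma gapless_max_0: "r > 0 \<Longrightarrow> gapless_max r 0 = {[]}"
  by (auto simp: gapless_max_def bounded_parts_0 gapless_def)

text \<open>Remove one copy of the largest part. Either another copy remains, or the rest has parts
  at most \<open>N\<close>; the window ending at \<open>Suc N\<close> was met by the removed part,
  so the rest only has to meet those ending by \<open>N\<close>.\<close>

lemma gapless_max_Suc:
  assumes "r > 0"
  shows "gapless_max r (Suc N) =
    (#) (Suc N) ` (gapless_max r (Suc N) \<union> gapless_bounded r N N)"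
proof -
  have *: "gapless r (Suc N) (Suc N # \<rho>) \<longleftrightarrow> gapless r N \<rho>"
    if "\<rho> \<in> bounded_parts N" for \<rho>
  proof
    assume L: "gapless r (Suc N) (Suc N # \<rho>)"
    show "gapless r N \<rho>"
      unfolding gapless_def
    proof (intro allI impI)
      fix k assume k: "0 < k" "k + r \<le> Suc N"
      then obtain i where "i < r" "k + i \<in> set (Suc N # \<rho>)"
        using L unfolding gapless_def by (meson le_SucI)
      then show "\<exists>i<r. k + i \<in> set \<rho>" using k by (intro exI[of _ i]) auto
    qed
  next
    assume R: "gapless r N \<rho>"
    show "gapless r (Suc N) (Suc N # \<rho>)"
      unfolding gapless_def
    proof (intro allI impI)
      fix k assume k: "0 < k" "k + r \<le> Suc (Suc N)"
      show "\<exists>i<r. k + i \<in> set (Suc N # \<rho>)"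
      proof (cases "k + r \<le> Suc N")
        case True
        then obtain i where "i < r" "k + i \<in> set \<rho>"
          using R k unfolding gapless_def by blast
        then show ?thesis by auto
      next
        case False
        \<comment> \<open>Here \<open>k + r = Suc (Suc N)\<close>, so \<open>Suc N\<close> is the
          last element of the window.\<close>
        then show ?thesis using k assms by (intro exI[of _ "r - 1"]) auto
      qed
    qed
  qed
  have **: "gapless r (Suc N) (Suc N # \<rho>) \<longleftrightarrow> gapless r (Suc N) \<rho>" if "Suc N \<in> set \<rho>" for \<rho>
    using that by (simp add: gapless_def insert_absorb)
  show ?thesis
  proof (intro set_eqI iffI)
    fix \<pi> assume pi: "\<pi> \<in> gapless_max r (Suc N)"
    then obtain \<rho> where \<rho>: "\<rho> \<in> bounded_parts (Suc N)" "\<pi> = Suc N # \<rho>"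
      using bounded_parts_Suc_iff[of \<pi> N] Suc_in_bounded_parts_iff[of \<pi> N]
      unfolding gapless_max_def by blast
    show "\<pi> \<in> (#) (Suc N) ` (gapless_max r (Suc N) \<union> gapless_bounded r N N)"
    proof (cases "Suc N \<in> set \<rho>")
      case True
      then have "\<rho> \<in> gapless_max r (Suc N)" using pi \<rho> ** by (auto simp: gapless_max_def)
      then show ?thesis using \<rho> by blast
    next
      case False
      then have "\<rho> \<in> gapless_bounded r N N"
        using pi \<rho> *[of \<rho>] Suc_in_bounded_parts_iff[of \<rho> N] by (auto simp: gapless_max_def gapless_bounded_def)
      then show ?thesis using \<rho> by blast
    qed
  next
    fix \<pi> assume "\<pi> \<in> (#) (Suc N) ` (gapless_max r (Suc N) \<union> gapless_bounded r N N)"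
    then obtain \<rho> where \<rho>: "\<pi> = Suc N # \<rho>"
      and "\<rho> \<in> gapless_max r (Suc N) \<or> \<rho> \<in> gapless_bounded r N N"
      by blast
    then have "\<rho> \<in> bounded_parts (Suc N)" "gapless r (Suc N) \<pi>"
      using *[of \<rho>] **[of \<rho>] bounded_parts_mono[of N "Suc N"] \<rho>
      by (auto simp: gapless_max_def gapless_bounded_def)
    then show "\<pi> \<in> gapless_max r (Suc N)"
      using \<rho> bounded_parts_Suc_iff[of \<pi> N] by (simp add: gapless_max_def)
  qed
qed

lemma gapless_antimono: "M \<le> N \<Longrightarrow> gapless r N \<pi> \<Longrightarrow> gapless r M \<pi>"
  by (auto simp: gapless_def)

lemma ex_largest_part:
  assumes "\<pi> \<in> bounded_parts N"
  shows "\<exists>M\<le>N. \<pi> \<in> bounded_parts M \<and> (M = 0 \<or> M \<in> set \<pi>)"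
  using assms
proof (induction N)
  case (Suc N)
  show ?case
  proof (cases "Suc N \<in> set \<pi>")
    case True
    then show ?thesis using Suc.prems by blast
  next
    case False
    then show ?thesis
      using Suc Suc_in_bounded_parts_iff by (meson le_SucI)
  qed
qed auto

text \<open>Split by the largest part \<open>N - i\<close>: everything above it is missing, so \<open>i < r\<close>.\<close>

lemma gapless_bounded_eq_Union:
  assumes "r > 0"
  shows "gapless_bounded r N N = (\<Union>i\<in>{i. i < r \<and> i \<le> N}. gapless_max r (N - i))"
proof (intro set_eqI iffI)
  fix \<pi> assume pi: "\<pi> \<in> gapless_bounded r N N"
  then obtain M where M: "M \<le> N" "\<pi> \<in> bounded_parts M" "M = 0 \<or> M \<in> set \<pi>"
    using ex_largest_part by (auto simp: gapless_bounded_def)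
  have "gapless r M \<pi>"
    using pi M gapless_antimono by (auto simp: gapless_bounded_def)
  moreover have "N - M < r"
  \<comment> \<open>Otherwise the window starting at \<open>Suc M\<close> fits below
    \<open>N\<close> but lies above every part.\<close>
  proof (rule ccontr)
    assume "\<not> N - M < r"
    then obtain i where "Suc M + i \<in> set \<pi>"
      using pi M by (auto simp: gapless_bounded_def gapless_def dest!: spec[of _ "Suc M"])
    then show False using M(2) by (auto simp: bounded_parts_def)
  qed
  ultimately show "\<pi> \<in> (\<Union>i\<in>{i. i < r \<and> i \<le> N}. gapless_max r (N - i))"
    using M by (intro UN_I[of "N - M"]) (auto simp: gapless_max_def)
next
  fix \<pi> assume "\<pi> \<in> (\<Union>i\<in>{i. i < r \<and> i \<le> N}. gapless_max r (N - i))"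
  then obtain i where i: "i < r" "i \<le> N" "\<pi> \<in> gapless_max r (N - i)" by blast
  have "gapless r N \<pi>"
    unfolding gapless_def
  proof (intro allI impI)
    fix k assume k: "0 < k" "k + r \<le> Suc N"
    show "\<exists>i<r. k + i \<in> set \<pi>"
    proof (cases "k + r \<le> Suc (N - i)")
      case True
      then show ?thesis using i k by (auto simp: gapless_max_def gapless_def)
    next
      case False
      \<comment> \<open>From \<open>i < r\<close> and \<open>k + r \<le> Suc N\<close> follows
        \<open>k \<le> N - i\<close>. Hence \<open>N - i\<close> is positive, so it is a genuine
        part, and it lies in the window.\<close>
      then have "N - i \<in> set \<pi>" "k \<le> N - i" "N - i - k < r"
        using i k by (auto simp: gapless_max_def)
      then show ?thesis
        by (metis le_add_diff_inverse)
    qed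
  qed
  then show "\<pi> \<in> gapless_bounded r N N"
    using i bounded_parts_mono[of "N - i" N]
    by (auto simp: gapless_max_def gapless_bounded_def)
qed

lemma gapless_max_disjoint:
  assumes "M \<noteq> N"
  shows "gapless_max r M \<inter> gapless_max r N = {}"
proof -
  have "gapless_max r M \<inter> gapless_max r N = {}" if "M < N" for M N
    using that by (auto simp: gapless_max_def bounded_parts_def)
  then show ?thesis using assms by (metis Int_commute nat_neq_iff)
qed

subsection \<open>Infinite products and generating functions\<close>

text \<open>The finite product (a;q)_n. The type is general because absolute convergence over the
  complex numbers is derived from the real case at \<open>norm q\<close>.\<close>

definition qpoch :: "'a::real_normed_field \<Rightarrow> 'a \<Rightarrow> nat \<Rightarrow> 'a" where
  "qpoch a q n = (\<Prod>k<n. 1 - a * q ^ k)"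

definition parts_gf :: "'a::{real_normed_field, banach} \<Rightarrow> nat list set \<Rightarrow> 'a" where
  "parts_gf q A = (\<Sum>\<^sub>\<infinity>\<pi>\<in>A. q ^ sum_list \<pi>)"

section \<open>Finite and infinite q-Pochhammer products\<close>

lemma qpoch_0 [simp]: "qpoch a q 0 = 1"
  by (simp add: qpoch_def)

lemma qpoch_Suc: "qpoch a q (Suc n) = qpoch a q n * (1 - a * q ^ n)"
  by (simp add: qpoch_def)

lemma norm_mult_power_less_one:
  fixes a q :: "'a::real_normed_div_algebra"
  assumes "norm a < 1" "norm q < 1"
  shows "norm (a * q ^ k) < 1"
proof -
  have "norm a * norm q ^ k \<le> norm a * 1"
    using assms by (intro mult_left_mono power_le_one) auto
  then show ?thesis
    using assms by (simp add: norm_mult norm_power)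
qed

lemma one_minus_ne_zero:
  fixes a :: "'a::real_normed_div_algebra"
  shows "norm a < 1 \<Longrightarrow> 1 - a \<noteq> 0"
  by auto

lemma qpoch_ne_zero:
  "norm a < 1 \<Longrightarrow> norm q < 1 \<Longrightarrow> qpoch a q n \<noteq> 0"
  unfolding qpoch_def by (simp add: norm_mult_power_less_one one_minus_ne_zero del: right_minus_eq)

lemma convergent_prod_qpoch:
  fixes a q :: "'a::{real_normed_field, banach}"
  assumes "norm q < 1"
  shows "convergent_prod (\<lambda>k. 1 - a * q ^ k)"
proof (intro abs_convergent_prod_imp_convergent_prod summable_imp_abs_convergent_prod)
  show "summable (\<lambda>k. norm (1 - a * q ^ k - 1))"
    using assms by (simp add: norm_mult norm_power summable_geometric)
qed

lemma qpoch_tendsto: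
  fixes a q :: "'a::{real_normed_field, banach}"
  assumes "norm q < 1"
  shows "qpoch a q \<longlonglongrightarrow> (\<Prod>k. 1 - a * q ^ k)"
proof (rule LIMSEQ_imp_Suc)
  show "(\<lambda>n. qpoch a q (Suc n)) \<longlonglongrightarrow> (\<Prod>k. 1 - a * q ^ k)"
    using convergent_prod_LIMSEQ[OF convergent_prod_qpoch[OF assms, of a]]
    by (simp add: qpoch_def lessThan_Suc_atMost)
qed

lemma prodinf_qpoch_ne_zero:
  fixes a q :: "'a::{real_normed_field, banach}"
  assumes "norm a < 1" "norm q < 1"
  shows "(\<Prod>k. 1 - a * q ^ k) \<noteq> 0"
  by (intro prodinf_nonzero convergent_prod_qpoch one_minus_ne_zero norm_mult_power_less_one assms)

lemma qpoch_split: "qpoch a q (m + n) = qpoch a q m * qpoch (a * q ^ m) q n"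
  by (induction n) (simp_all add: qpoch_Suc power_add mult_ac)

lemma qpoch_inf_tendsto: "norm q < 1 \<Longrightarrow> qpoch a q \<longlonglongrightarrow> qpoch_inf a q"
  unfolding qpoch_inf_def by (rule qpoch_tendsto)

lemma qpoch_inf_ne_zero: "norm a < 1 \<Longrightarrow> norm q < 1 \<Longrightarrow> qpoch_inf a q \<noteq> 0"
  unfolding qpoch_inf_def by (rule prodinf_qpoch_ne_zero)

lemma qpoch_inf_split:
  assumes "norm q < 1"
  shows "qpoch_inf a q = qpoch a q m * qpoch_inf (a * q ^ m) q"
proof (rule LIMSEQ_unique)
  show "(\<lambda>n. qpoch a q (n + m)) \<longlonglongrightarrow> qpoch_inf a q"
    using qpoch_inf_tendsto[OF assms] by (rule LIMSEQ_ignore_initial_segment)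
  have "(\<lambda>n. qpoch a q m * qpoch (a * q ^ m) q n) \<longlonglongrightarrow> qpoch a q m * qpoch_inf (a * q ^ m) q"
    using qpoch_inf_tendsto[OF assms] by (rule tendsto_mult_left)
  then show "(\<lambda>n. qpoch a q (n + m)) \<longlonglongrightarrow> qpoch a q m * qpoch_inf (a * q ^ m) q"
    by (simp add: qpoch_split [symmetric] add.commute)
qed

text \<open>The products tend to a nonzero limit, so their reciprocals converge. The uniform bound
  provides the majorants for partition sums and for Euler's series.\<close>

lemma bounded_inverse_qpoch:
  fixes a q :: "'a::{real_normed_field, banach}"
  assumes "norm a < 1" "norm q < 1"
  obtains B where "B > 0" "\<And>n. norm (1 / qpoch a q n) \<le> B"
proof -
  have "(\<lambda>n. 1 / qpoch a q n) \<longlonglongrightarrow> 1 / (\<Prod>k. 1 - a * q ^ k)"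
    using prodinf_qpoch_ne_zero[OF assms] qpoch_tendsto[OF assms(2)] by (intro tendsto_intros)
  then have "Bseq (\<lambda>n. 1 / qpoch a q n)"
    by (rule convergentI[THEN convergent_imp_Bseq])
  then show ?thesis
    using that by (auto simp: Bseq_def)
qed

lemma qpoch_real_pos:
  fixes x :: real
  assumes "0 \<le> x" "x < 1"
  shows "0 < qpoch x x n"
proof -
  have "x * x ^ k < 1" for k
    using norm_mult_power_less_one[of x x k] assms by simp
  then show ?thesis by (auto simp: qpoch_def intro!: prod_pos)
qed

section \<open>Absolute convergence of the sum over all partitions\<close>

lemma finite_bounded_parts_length: "finite {\<pi> \<in> bounded_parts L. length \<pi> \<le> n}"
  by (rule finite_subset[OF _ finite_lists_length_le[of "{0<..L}" n]]) (auto simp: bounded_parts_def)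

text \<open>Bounding the length keeps the sums finite, which makes a double induction possible before
  summability is known.\<close>

lemma sum_bounded_parts_length_le:
  fixes x :: real
  assumes "0 \<le> x" "x < 1"
  shows "(\<Sum>\<pi> | \<pi> \<in> bounded_parts L \<and> length \<pi> \<le> n. x ^ sum_list \<pi>) \<le> 1 / qpoch x x L"
    (is "?s L n \<le> _")
proof (induction L arbitrary: n)
  case 0
  have "{\<pi>. \<pi> \<in> bounded_parts 0 \<and> length \<pi> \<le> n} = {[]}"
    by (auto simp: bounded_parts_0)
  then show ?case by simp
next
  case (Suc L)
  note IH = this
  let ?A = "\<lambda>L n. {\<pi>. \<pi> \<in> bounded_parts L \<and> length \<pi> \<le> n}"
  let ?p = "\<lambda>L. 1 / qpoch x x L"
  have less: "x ^ Suc L < 1"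
    using norm_mult_power_less_one[of x x L] assms by simp
  have pos: "qpoch x x m > 0" for m
    using assms by (rule qpoch_real_pos)
  \<comment> \<open>The bound satisfies with equality the recurrence that the truncated sums satisfy
    as an inequality.\<close>
  have eq: "?p L + x ^ Suc L * ?p (Suc L) = ?p (Suc L)"
    using pos[of L] less by (simp add: qpoch_Suc field_simps)
  show ?case
  proof (induction n)
    case 0
    have "?A (Suc L) 0 = {[]}"
      by (auto simp: bounded_parts_def)
    moreover have "qpoch x x (Suc L) \<le> 1"
      unfolding qpoch_def using assms norm_mult_power_less_one[of x x]
      by (intro prod_le_1) (auto intro: less_imp_le)
    ultimately show ?case
      using pos by simp
  next
    case (Suc n)
    have fin: "finite (?A M m)" for M m
      using finite_bounded_parts_length by simp
    have "?A (Suc L) (Suc n) \<subseteq> ?A L (Suc n) \<union> (#) (Suc L) ` ?A (Suc L) n"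
    proof
      fix \<pi> assume pi: "\<pi> \<in> ?A (Suc L) (Suc n)"
      then consider "\<pi> \<in> bounded_parts L" | \<rho> where "\<rho> \<in> bounded_parts (Suc L)" "\<pi> = Suc L # \<rho>"
        using bounded_parts_Suc_iff[of \<pi> L] by blast
      then show "\<pi> \<in> ?A L (Suc n) \<union> (#) (Suc L) ` ?A (Suc L) n"
        using pi by cases auto
    qed
    then have "?s (Suc L) (Suc n) \<le> (\<Sum>\<pi>\<in>?A L (Suc n) \<union> (#) (Suc L) ` ?A (Suc L) n. x ^ sum_list \<pi>)"
      using fin assms by (intro sum_mono2) auto
    also have "\<dots> \<le> ?s L (Suc n) + (\<Sum>\<pi>\<in>(#) (Suc L) ` ?A (Suc L) n. x ^ sum_list \<pi>)"
      using fin assms by (subst sum.union_inter [symmetric]) (auto intro!: sum_nonneg)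
    also have "(\<Sum>\<pi>\<in>(#) (Suc L) ` ?A (Suc L) n. x ^ sum_list \<pi>) = x ^ Suc L * ?s (Suc L) n"
      by (subst sum.reindex) (auto simp: sum_distrib_left power_add mult_ac)
    also have "?s L (Suc n) + x ^ Suc L * ?s (Suc L) n \<le> ?p L + x ^ Suc L * ?p (Suc L)"
      using IH Suc assms by (intro add_mono mult_left_mono) auto
    finally show ?case
      unfolding eq .
  qed
qed

text \<open>Every finite set of partitions has bounded part size and length, so the truncated
  estimate applies to it, and its bound is uniform in \<open>L\<close>.\<close>

lemma summable_on_all_parts_real:
  fixes x :: real
  assumes "0 \<le> x" "x < 1"
  shows "(\<lambda>\<pi>. x ^ sum_list \<pi>) summable_on all_parts"
proof -
  obtain B where B: "\<And>n. norm (1 / qpoch x x n) \<le> B"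
    using assms bounded_inverse_qpoch[of x x] by auto
  have "(\<Sum>\<pi>\<in>F. x ^ sum_list \<pi>) \<le> B" if F: "F \<subseteq> all_parts" "finite F" for F
  proof -
    have "\<exists>L n. \<forall>\<pi>\<in>F. \<pi> \<in> bounded_parts L \<and> length \<pi> \<le> n"
      using F(2,1)
    proof (induction F rule: finite_induct)
      case (insert \<rho> F)
      then obtain L n M where "\<forall>\<pi>\<in>F. \<pi> \<in> bounded_parts L \<and> length \<pi> \<le> n" "\<rho> \<in> bounded_parts M"
        unfolding all_parts_eq_Union by auto
      then show ?case
        using bounded_parts_mono[of L "max L M"] bounded_parts_mono[of M "max L M"]
        by (intro exI[of _ "max L M"] exI[of _ "max n (length \<rho>)"]) auto
    qed auto
    then obtain L n where "F \<subseteq> {\<pi>. \<pi> \<in> bounded_parts L \<and> length \<pi> \<le> n}"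
      by auto
    then have "(\<Sum>\<pi>\<in>F. x ^ sum_list \<pi>) \<le> 1 / qpoch x x L"
      using assms finite_bounded_parts_length[of L n]
      by (intro order_trans[OF sum_mono2 sum_bounded_parts_length_le[of x L n]]) auto
    then show ?thesis
      using B[of L] qpoch_real_pos[OF assms, of L] by simp
  qed
  then show ?thesis
    using assms by (intro nonneg_bdd_above_summable_on) (auto intro!: bdd_aboveI2)
qed

lemma abs_summable_on_all_parts:
  fixes q :: "'a::real_normed_field"
  assumes "norm q < 1" "A \<subseteq> all_parts"
  shows "(\<lambda>\<pi>. norm (q ^ sum_list \<pi>)) summable_on A"
  using summable_on_subset_banach[OF summable_on_all_parts_real assms(2)] assms(1)
  by (simp add: norm_power)

lemma summable_on_all_parts:
  fixes q :: "'a::{real_normed_field, banach}"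
  assumes "norm q < 1" "A \<subseteq> all_parts"
  shows "(\<lambda>\<pi>. q ^ sum_list \<pi>) summable_on A"
  using abs_summable_on_all_parts[OF assms] by (rule abs_summable_summable)

section \<open>Additivity and continuity of generating functions\<close>

lemma parts_gf_has_sum:
  fixes q :: "'a::{real_normed_field, banach}"
  assumes "norm q < 1" "A \<subseteq> all_parts"
  shows "((\<lambda>\<pi>. q ^ sum_list \<pi>) has_sum parts_gf q A) A"
  unfolding parts_gf_def using summable_on_all_parts[OF assms] by (rule has_sum_infsum)

lemma parts_gf_Un:
  fixes q :: "'a::{real_normed_field, banach}"
  assumes "norm q < 1" "A \<subseteq> all_parts" "B \<subseteq> all_parts" "A \<inter> B = {}"
  shows "parts_gf q (A \<union> B) = parts_gf q A + parts_gf q B"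
  unfolding parts_gf_def by (intro infsum_Un_disjoint summable_on_all_parts assms)

lemma parts_gf_UN:
  fixes q :: "'a::{real_normed_field, banach}"
  assumes "norm q < 1" "finite I" "\<And>i. i \<in> I \<Longrightarrow> A i \<subseteq> all_parts"
    and "\<And>i j. i \<in> I \<Longrightarrow> j \<in> I \<Longrightarrow> i \<noteq> j \<Longrightarrow> A i \<inter> A j = {}"
  shows "parts_gf q (\<Union>i\<in>I. A i) = (\<Sum>i\<in>I. parts_gf q (A i))"
  unfolding parts_gf_def using assms by (subst sum_infsum) (auto intro!: summable_on_all_parts)

lemma parts_gf_Cons:
  fixes q :: "'a::{real_normed_field, banach}"
  shows "parts_gf q ((#) p ` A) = q ^ p * parts_gf q A"
  unfolding parts_gf_def
  by (subst infsum_reindex) (auto simp: power_add infsum_cmult_right' o_def)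

text \<open>A finite \<open>F\<close> captures the total up to e/2, also after enlarging it within
  the union. Once \<open>A L\<close> contains \<open>F\<close>, the finite subsets of
  \<open>A L\<close> above \<open>F\<close> obey the same estimate, which passes to their
  limit.\<close>

lemma parts_gf_tendsto:
  fixes q :: "'a::{real_normed_field, banach}"
  assumes q: "norm q < 1" and A: "\<And>L. A L \<subseteq> A (Suc L)" "\<And>L. A L \<subseteq> all_parts"
  shows "(\<lambda>L. parts_gf q (A L)) \<longlonglongrightarrow> parts_gf q (\<Union>L. A L)"
proof (rule LIMSEQ_I)
  fix e :: real assume e: "e > 0"
  let ?f = "\<lambda>\<pi>. q ^ sum_list \<pi>"
  define U where "U = (\<Union>L. A L)"
  have U: "U \<subseteq> all_parts" "\<And>L. A L \<subseteq> U"
    using A by (auto simp: U_def)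
  have "(sum ?f \<longlongrightarrow> parts_gf q U) (finite_subsets_at_top U)"
    unfolding parts_gf_def using U q by (intro infsum_tendsto summable_on_all_parts)
  then have "\<forall>\<^sub>F F in finite_subsets_at_top U. dist (sum ?f F) (parts_gf q U) < e / 2"
    using e by (intro tendstoD) auto
  then obtain F where F: "finite F" "F \<subseteq> U"
    "\<And>G. finite G \<Longrightarrow> F \<subseteq> G \<Longrightarrow> G \<subseteq> U \<Longrightarrow> dist (sum ?f G) (parts_gf q U) < e / 2"
    unfolding eventually_finite_subsets_at_top by (elim exE conjE) (rule that, auto)
  have mono: "A L \<subseteq> A M" if "L \<le> M" for L M
    using A(1) that by (rule lift_Suc_mono_le)
  have "\<exists>M. F \<subseteq> A M"
    using F(1,2)
  proof (induction F rule: finite_induct)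
    case (insert \<pi> F)
    then obtain M L where "F \<subseteq> A M" "\<pi> \<in> A L" by (auto simp: U_def)
    then show ?case using mono[of M "max L M"] mono[of L "max L M"]
      by (intro exI[of _ "max L M"]) auto
  qed auto
  then obtain M where M: "F \<subseteq> A M" by blast
  have "norm (parts_gf q (A L) - parts_gf q U) < e" if L: "L \<ge> M" for L
  proof -
    have "(sum ?f \<longlongrightarrow> parts_gf q (A L)) (finite_subsets_at_top (A L))"
      unfolding parts_gf_def using A q by (intro infsum_tendsto summable_on_all_parts)
    then have lim: "((\<lambda>G. dist (sum ?f G) (parts_gf q U)) \<longlongrightarrow> dist (parts_gf q (A L)) (parts_gf q U))
        (finite_subsets_at_top (A L))"
      by (intro tendsto_intros)
    have "\<forall>\<^sub>F G in finite_subsets_at_top (A L). dist (sum ?f G) (parts_gf q U) \<le> e / 2"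
      unfolding eventually_finite_subsets_at_top
    proof (intro exI[of _ F] conjI allI impI)
      fix G assume "finite G \<and> F \<subseteq> G \<and> G \<subseteq> A L"
      then have "dist (sum ?f G) (parts_gf q U) < e / 2"
        using F(3)[of G] U(2)[of L] by blast
      then show "dist (sum ?f G) (parts_gf q U) \<le> e / 2" by simp
    qed (use F M mono[OF L] in auto)
    then have "dist (parts_gf q (A L)) (parts_gf q U) \<le> e / 2"
      using lim by (intro tendsto_upperbound) auto
    then show ?thesis using e by (simp add: dist_norm)
  qed
  then show "\<exists>M. \<forall>L\<ge>M. norm (parts_gf q (A L) - parts_gf q (\<Union>L. A L)) < e" unfolding U_def by blast
qed

subsection \<open>Recurrences and the functional equation\<close>

lemma gapless_bounded_subset: "gapless_bounded r N L \<subseteq> all_parts"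
  by (auto simp: gapless_bounded_def all_parts_eq_Union)

lemma gapless_max_subset: "gapless_max r N \<subseteq> all_parts"
  by (auto simp: gapless_max_def all_parts_eq_Union)

lemma gapless_all_eq_Union: "gapless_all r N = (\<Union>L. gapless_bounded r N L)"
  by (auto simp: gapless_all_def gapless_bounded_def all_parts_eq_Union)

lemma gapless_all_eq_all_parts: "N < r \<Longrightarrow> gapless_all r N = all_parts"
  by (auto simp: gapless_all_def gapless_def)

lemma parts_gf_singleton_Nil [simp]: "parts_gf q {[]} = 1"
  by (simp add: parts_gf_def)

lemma parts_gf_gapless_bounded_Suc:
  fixes q :: "'a::{real_normed_field, banach}"
  assumes "norm q < 1" "N \<le> L"
  shows "parts_gf q (gapless_bounded r N (Suc L)) * (1 - q ^ Suc L) = parts_gf q (gapless_bounded r N L)"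
proof -
  have "gapless_bounded r N L \<inter> (#) (Suc L) ` gapless_bounded r N (Suc L) = {}"
    by (auto simp: gapless_bounded_def bounded_parts_def)
  moreover have "(#) (Suc L) ` gapless_bounded r N (Suc L) \<subseteq> all_parts"
    using gapless_bounded_Suc[OF assms(2)] gapless_bounded_subset by blast
  ultimately have "parts_gf q (gapless_bounded r N (Suc L)) =
      parts_gf q (gapless_bounded r N L) + q ^ Suc L * parts_gf q (gapless_bounded r N (Suc L))"
    using parts_gf_Un[OF assms(1) gapless_bounded_subset] gapless_bounded_Suc[OF assms(2)]
    by (metis parts_gf_Cons)
  then show ?thesis
    by (simp add: algebra_simps)
qed

text \<open>Each part size \<open>L > N\<close> is unconstrained and contributes 1 / (1 - q^L),
  which the new factor of \<open>qpoch q q L\<close> cancels.\<close>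

lemma parts_gf_gapless_bounded:
  fixes q :: "'a::{real_normed_field, banach}"
  assumes "norm q < 1" "N \<le> L"
  shows "parts_gf q (gapless_bounded r N L) * qpoch q q L =
    parts_gf q (gapless_bounded r N N) * qpoch q q N"
  using assms(2)
proof (induction L rule: dec_induct)
  case (step L)
  then show ?case
    using parts_gf_gapless_bounded_Suc[OF assms(1) step(1), of r]
    by (simp add: qpoch_Suc mult_ac)
qed simp

lemma parts_gf_gapless_all:
  fixes q :: "'a::{real_normed_field, banach}"
  assumes "norm q < 1"
  shows "parts_gf q (gapless_all r N) * (\<Prod>k. 1 - q * q ^ k) =
    parts_gf q (gapless_bounded r N N) * qpoch q q N"
proof (rule LIMSEQ_unique)
  have "gapless_bounded r N L \<subseteq> gapless_bounded r N (Suc L)" for L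
    using bounded_parts_mono[of L "Suc L"] by (auto simp: gapless_bounded_def)
  then show "(\<lambda>L. parts_gf q (gapless_bounded r N L) * qpoch q q L)
      \<longlonglongrightarrow> parts_gf q (gapless_all r N) * (\<Prod>k. 1 - q * q ^ k)"
    unfolding gapless_all_eq_Union
    by (intro tendsto_mult parts_gf_tendsto qpoch_tendsto assms gapless_bounded_subset)
  have "\<forall>\<^sub>F L in sequentially. parts_gf q (gapless_bounded r N L) * qpoch q q L =
      parts_gf q (gapless_bounded r N N) * qpoch q q N"
    using eventually_ge_at_top[of N]
    by eventually_elim (rule parts_gf_gapless_bounded[OF assms])
  then show "(\<lambda>L. parts_gf q (gapless_bounded r N L) * qpoch q q L)
      \<longlonglongrightarrow> parts_gf q (gapless_bounded r N N) * qpoch q q N"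
    by (rule tendsto_eventually)
qed

lemma parts_gf_all_parts:
  fixes q :: "'a::{real_normed_field, banach}"
  assumes "norm q < 1"
  shows "parts_gf q all_parts * (\<Prod>k. 1 - q * q ^ k) = 1"
proof -
  \<comment> \<open>For \<open>r = 1\<close>, \<open>N = 0\<close> no window exists, so this
    instance counts all partitions.\<close>
  have "gapless_bounded 1 0 0 = {[]}"
    by (auto simp: gapless_bounded_def bounded_parts_0 gapless_def)
  then show ?thesis
    using parts_gf_gapless_all[OF assms, of 1 0] by (simp add: gapless_all_eq_all_parts)
qed

lemma parts_gf_gapless_max_Suc:
  fixes q :: "'a::{real_normed_field, banach}"
  assumes "norm q < 1" "r > 0"
  shows "parts_gf q (gapless_max r (Suc N)) * (1 - q ^ Suc N) =
    q ^ Suc N * parts_gf q (gapless_bounded r N N)"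
proof -
  have "gapless_max r (Suc N) \<inter> gapless_bounded r N N = {}"
    by (auto simp: gapless_max_def gapless_bounded_def bounded_parts_def)
  then have "parts_gf q (gapless_max r (Suc N) \<union> gapless_bounded r N N) =
      parts_gf q (gapless_max r (Suc N)) + parts_gf q (gapless_bounded r N N)"
    by (intro parts_gf_Un assms gapless_max_subset gapless_bounded_subset)
  then have "parts_gf q (gapless_max r (Suc N)) =
      q ^ Suc N * (parts_gf q (gapless_max r (Suc N)) + parts_gf q (gapless_bounded r N N))"
    using gapless_max_Suc[OF assms(2), of N] by (metis parts_gf_Cons)
  then show ?thesis
    by (simp add: algebra_simps)
qed

lemma parts_gf_gapless_bounded_eq_sum:
  fixes q :: "'a::{real_normed_field, banach}"
  assumes "norm q < 1" "r > 0"
  shows "parts_gf q (gapless_bounded r N N) =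
    (\<Sum>i<r. if i \<le> N then parts_gf q (gapless_max r (N - i)) else 0)"
proof -
  have "gapless_max r (N - i) \<inter> gapless_max r (N - j) = {}" if "i \<le> N" "j \<le> N" "i \<noteq> j" for i j
    using that by (intro gapless_max_disjoint) auto
  then have "parts_gf q (gapless_bounded r N N) =
      (\<Sum>i\<in>{i. i < r \<and> i \<le> N}. parts_gf q (gapless_max r (N - i)))"
    unfolding gapless_bounded_eq_Union[OF assms(2)]
    by (intro parts_gf_UN assms gapless_max_subset) auto
  also have "\<dots> = (\<Sum>i<r. if i \<le> N then parts_gf q (gapless_max r (N - i)) else 0)"
    by (rule sum.mono_neutral_cong_left) auto
  finally show ?thesis .
qed

text \<open>The recurrence bounds a term by the previous \<open>r\<close> terms times a factor that
  tends to 0, so eventually the ratio 1/2 is maintained.\<close>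

lemma gapless_max_geometric_bound:
  fixes q :: "'a::{real_normed_field, banach}"
  assumes q: "norm q < 1" and r: "r > 0"
  obtains K where "\<And>N. norm (parts_gf q (gapless_max r N)) \<le> K * (1 / 2) ^ N"
proof -
  define T where "T N = norm (parts_gf q (gapless_max r N))" for N
  \<comment> \<open>If the previous terms obey the bound, then T (M - i) is at most K (1/2)^(M+1)
    2^(i+1); \<open>D\<close> collects these powers of 2.\<close>
  define D :: real where "D = (\<Sum>i<r. 2 ^ Suc i)"
  have rec: "T (Suc N) \<le> norm q ^ Suc N / (1 - norm q) * (\<Sum>i<r. if i \<le> N then T (N - i) else 0)" for N
  proof -
    have "1 - norm q \<le> 1 - norm q ^ Suc N"
      using power_decreasing[of 1 "Suc N" "norm q"] q by simp
    also have "\<dots> \<le> norm (1 - q ^ Suc N)"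
      using norm_triangle_ineq2[of 1 "q ^ Suc N"] by (simp add: norm_power norm_mult)
    finally have "T (Suc N) * (1 - norm q) \<le> T (Suc N) * norm (1 - q ^ Suc N)"
      by (intro mult_left_mono) (auto simp: T_def)
    also have "\<dots> = norm q ^ Suc N * norm (parts_gf q (gapless_bounded r N N))"
      unfolding T_def norm_mult [symmetric] parts_gf_gapless_max_Suc[OF q r]
      by (simp add: norm_mult norm_power)
    also have "\<dots> \<le> norm q ^ Suc N * (\<Sum>i<r. if i \<le> N then T (N - i) else 0)"
    proof (rule mult_left_mono)
      show "norm (parts_gf q (gapless_bounded r N N)) \<le> (\<Sum>i<r. if i \<le> N then T (N - i) else 0)"
        unfolding parts_gf_gapless_bounded_eq_sum[OF q r]
        by (rule sum_norm_le) (simp add: T_def)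
    qed simp
    finally show ?thesis
      using q by (simp add: pos_le_divide_eq)
  qed
  have "(\<lambda>N. norm q ^ Suc N / (1 - norm q) * D) \<longlonglongrightarrow> 0 / (1 - norm q) * D"
    using q by (intro tendsto_intros LIMSEQ_Suc LIMSEQ_power_zero) auto
  then have "\<forall>\<^sub>F N in sequentially. norm q ^ Suc N / (1 - norm q) * D < 1"
    by (rule order_tendstoD) simp
  then obtain N0 where N0: "\<And>N. N \<ge> N0 \<Longrightarrow> norm q ^ Suc N / (1 - norm q) * D < 1"
    by (auto simp: eventually_at_top_linorder)
  \<comment> \<open>Chosen so that the bound holds for every index up to \<open>N0\<close>, where
    the contraction is not yet available.\<close>
  define K where "K = (\<Sum>n\<le>N0. T n * 2 ^ n)"
  have K0: "K \<ge> 0"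
    unfolding K_def T_def by (intro sum_nonneg) auto
  have "T N \<le> K * (1 / 2) ^ N" for N
  proof (induction N rule: less_induct)
    case (less N)
    show ?case
    proof (cases "N \<le> N0")
      case True
      then have "T N * 2 ^ N \<le> K"
        unfolding K_def by (intro member_le_sum) (auto simp: T_def)
      then show ?thesis by (simp add: field_simps)
    next
      case False
      then obtain M where M: "N = Suc M" "N0 \<le> M" by (cases N) auto
      have "(\<Sum>i<r. if i \<le> M then T (M - i) else 0) \<le> (\<Sum>i<r. K * (1 / 2) ^ N * 2 ^ Suc i)"
      proof (rule sum_mono)
        fix i
        show "(if i \<le> M then T (M - i) else 0) \<le> K * (1 / 2) ^ N * 2 ^ Suc i"
        proof (cases "i \<le> M")
          case True
          then have "T (M - i) \<le> K * (1 / 2) ^ (M - i)"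
            using less M by auto
          also have "(1 / 2 :: real) ^ (M - i) = (1 / 2) ^ N * 2 ^ Suc i"
            using True M by (simp add: power_diff field_simps)
          finally show ?thesis using True by simp
        qed (use K0 in auto)
      qed
      also have "\<dots> = K * (1 / 2) ^ N * D"
        by (simp add: D_def sum_distrib_left)
      finally have *: "(\<Sum>i<r. if i \<le> M then T (M - i) else 0) \<le> K * (1 / 2) ^ N * D" .
      have "T N \<le> norm q ^ Suc M / (1 - norm q) * (\<Sum>i<r. if i \<le> M then T (M - i) else 0)"
        using rec[of M] M by simp
      also have "\<dots> \<le> norm q ^ Suc M / (1 - norm q) * (K * (1 / 2) ^ N * D)"
        using * q by (intro mult_left_mono) auto
      also have "\<dots> = (norm q ^ Suc M / (1 - norm q) * D) * (K * (1 / 2) ^ N)"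
        by (simp add: mult_ac)
      also have "\<dots> \<le> 1 * (K * (1 / 2) ^ N)"
        using N0[OF M(2)] K0 by (intro mult_right_mono) auto
      finally show ?thesis by simp
    qed
  qed
  then show ?thesis
    using that by (auto simp: T_def)
qed

section \<open>The power series of \<open>T\<close> and its values at powers of
  \<open>q\<close>\<close>

lemma sums_shift_right:
  fixes f :: "nat \<Rightarrow> 'a::real_normed_vector"
  assumes "f sums s"
  shows "(\<lambda>n. if i \<le> n then f (n - i) else 0) sums s"
  using assms sums_zero_iff_shift[of i "\<lambda>n. if i \<le> n then f (n - i) else 0" s] by simp

text \<open>As a power series in \<open>z\<close>, \<open>max_gf r q z\<close> equals
  \<open>\<Prod>k\<ge>1. (1 - (z q\<^sup>k)\<^bsup>r+1\<^esup>) / (1 - z q\<^sup>k)\<close>; only its values at powers of \<open>q\<close> are needed.\<close>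

definition max_gf :: "nat \<Rightarrow> 'a::{real_normed_field, banach} \<Rightarrow> 'a \<Rightarrow> 'a" where
  "max_gf r q z = (\<Sum>N. parts_gf q (gapless_max r N) * z ^ N)"

lemma summable_norm_gapless_max:
  fixes q :: "'a::{real_normed_field, banach}"
  assumes "norm q < 1" "r > 0"
  shows "summable (\<lambda>N. norm (parts_gf q (gapless_max r N)))"
proof -
  obtain K where "\<And>N. norm (parts_gf q (gapless_max r N)) \<le> K * (1 / 2) ^ N"
    using gapless_max_geometric_bound[OF assms] by blast
  then have "norm (norm (parts_gf q (gapless_max r N))) \<le> K * (1 / 2) ^ N" for N
    by simp
  moreover have "summable (\<lambda>N. K * (1 / 2 :: real) ^ N)"
    by (intro summable_mult summable_geometric) simp
  ultimately show ?thesis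
    by (metis summable_comparison_test')
qed

text \<open>The closed disk is required: the double series evaluates \<open>max_gf\<close> at q^j,
  and j = 0 gives the boundary point 1.\<close>

lemma max_gf_sums:
  fixes q :: "'a::{real_normed_field, banach}"
  assumes "norm q < 1" "r > 0" "norm z \<le> 1"
  shows "(\<lambda>N. parts_gf q (gapless_max r N) * z ^ N) sums max_gf r q z"
  unfolding max_gf_def
proof (rule summable_sums, rule summable_norm_cancel, rule summable_comparison_test')
  show "summable (\<lambda>N. norm (parts_gf q (gapless_max r N)))"
    using assms by (intro summable_norm_gapless_max)
  show "norm (norm (parts_gf q (gapless_max r N) * z ^ N)) \<le> norm (parts_gf q (gapless_max r N))" for N
    using assms(3) by (simp add: norm_mult norm_power mult_left_le power_le_one)
qed

lemma summable_norm_gapless_bounded: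
  fixes q :: "'a::{real_normed_field, banach}"
  assumes "norm q < 1" "r > 0"
  shows "summable (\<lambda>N. norm (parts_gf q (gapless_bounded r N N)))"
proof (rule summable_comparison_test')
  let ?T = "\<lambda>N. norm (parts_gf q (gapless_max r N))"
  show "summable (\<lambda>N. \<Sum>i<r. if i \<le> N then ?T (N - i) else 0)"
    using sums_shift_right[OF summable_sums[OF summable_norm_gapless_max[OF assms]]]
    by (intro summable_sum) (rule sums_summable)
  show "norm (norm (parts_gf q (gapless_bounded r N N))) \<le> (\<Sum>i<r. if i \<le> N then ?T (N - i) else 0)" for N
    unfolding parts_gf_gapless_bounded_eq_sum[OF assms] real_norm_def abs_norm_cancel by (rule sum_norm_le) simp
qed

text \<open>\<open>C\<close> is the convolution of \<open>T\<close> with \<open>r\<close> ones,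
  which multiplies the series by 1 + z + ... + z^(r-1).\<close>

lemma gapless_bounded_sums:
  fixes q :: "'a::{real_normed_field, banach}"
  assumes "norm q < 1" "r > 0" "norm z \<le> 1"
  shows "(\<lambda>N. parts_gf q (gapless_bounded r N N) * z ^ N) sums ((\<Sum>i<r. z ^ i) * max_gf r q z)"
proof -
  let ?f = "\<lambda>N. parts_gf q (gapless_max r N) * z ^ N"
  have "(\<lambda>N. \<Sum>i<r. z ^ i * (if i \<le> N then ?f (N - i) else 0)) sums (\<Sum>i<r. z ^ i * max_gf r q z)"
    by (intro sums_sum sums_mult sums_shift_right max_gf_sums assms)
  also have "(\<lambda>N. \<Sum>i<r. z ^ i * (if i \<le> N then ?f (N - i) else 0)) =
      (\<lambda>N. parts_gf q (gapless_bounded r N N) * z ^ N)"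
  proof
    fix N
    have "z ^ i * (if i \<le> N then ?f (N - i) else 0) =
        (if i \<le> N then parts_gf q (gapless_max r (N - i)) else 0) * z ^ N" for i
      by (simp add: power_add [symmetric])
    then show "(\<Sum>i<r. z ^ i * (if i \<le> N then ?f (N - i) else 0)) =
        parts_gf q (gapless_bounded r N N) * z ^ N"
      unfolding parts_gf_gapless_bounded_eq_sum[OF assms(1,2)] sum_distrib_right by simp
  qed
  finally show ?thesis
    by (simp add: sum_distrib_right)
qed

text \<open>In the difference of the values at z and zq the coefficient of z^(N+1) is (1 - q^(N+1))
  T (N+1) = q^(N+1) C N. The difference is therefore zq times the series of \<open>C\<close> at
  zq.\<close>

lemma max_gf_functional_equation:
  fixes q :: "'a::{real_normed_field, banach}"
  assumes "norm q < 1" "r > 0" "norm z \<le> 1"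
  shows "(1 - z * q) * max_gf r q z = (1 - (z * q) ^ Suc r) * max_gf r q (z * q)"
proof -
  let ?T = "\<lambda>N. parts_gf q (gapless_max r N)"
  let ?w = "z * q"
  have w: "norm ?w \<le> 1"
    using assms by (simp add: norm_mult mult_le_one)
  have "(\<lambda>N. ?T (Suc N) * z ^ Suc N - ?T (Suc N) * ?w ^ Suc N) =
      (\<lambda>N. ?w * (parts_gf q (gapless_bounded r N N) * ?w ^ N))"
  proof
    fix N
    have "?T (Suc N) * z ^ Suc N - ?T (Suc N) * ?w ^ Suc N = ?T (Suc N) * (1 - q ^ Suc N) * z ^ Suc N"
      by (simp add: algebra_simps power_mult_distrib)
    also have "\<dots> = ?w * (parts_gf q (gapless_bounded r N N) * ?w ^ N)"
      unfolding parts_gf_gapless_max_Suc[OF assms(1,2)] by (simp add: power_mult_distrib)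
    finally show "?T (Suc N) * z ^ Suc N - ?T (Suc N) * ?w ^ Suc N =
        ?w * (parts_gf q (gapless_bounded r N N) * ?w ^ N)" .
  qed
  moreover have "(\<lambda>N. ?w * (parts_gf q (gapless_bounded r N N) * ?w ^ N)) sums
      (?w * ((\<Sum>i<r. ?w ^ i) * max_gf r q ?w))"
    by (intro sums_mult gapless_bounded_sums assms w)
  \<comment> \<open>The term at \<open>N = 0\<close> is zero, so shifting the index does not change
    the sum.\<close>
  ultimately have "(\<lambda>N. ?T N * z ^ N - ?T N * ?w ^ N) sums (?w * ((\<Sum>i<r. ?w ^ i) * max_gf r q ?w))"
    using sums_Suc_iff[of "\<lambda>N. ?T N * z ^ N - ?T N * ?w ^ N"] by simp
  moreover have "(\<lambda>N. ?T N * z ^ N - ?T N * ?w ^ N) sums (max_gf r q z - max_gf r q ?w)"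
    by (intro sums_diff max_gf_sums assms w)
  ultimately have "max_gf r q z - max_gf r q ?w = ?w * ((\<Sum>i<r. ?w ^ i) * max_gf r q ?w)"
    by (rule sums_unique2 [rotated])
  then have "max_gf r q z = (1 + ?w * (\<Sum>i<r. ?w ^ i)) * max_gf r q ?w"
    by (simp add: algebra_simps)
  also have "1 + ?w * (\<Sum>i<r. ?w ^ i) = (\<Sum>i<Suc r. ?w ^ i)"
    unfolding sum.lessThan_Suc_shift by (simp add: sum_distrib_left)
  finally show ?thesis
    unfolding one_diff_power_eq[of ?w "Suc r"] by simp
qed

lemma max_gf_tendsto_1:
  fixes q :: "'a::{real_normed_field, banach}"
  assumes "norm q < 1" "r > 0"
  shows "(\<lambda>j. max_gf r q (q ^ j)) \<longlonglongrightarrow> 1"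
proof -
  have "isCont (max_gf r q) 0"
    unfolding max_gf_def
    by (rule isCont_powser[of _ 1]) (use max_gf_sums[OF assms, of 1] in \<open>auto simp: sums_iff\<close>)
  then have "(\<lambda>j. max_gf r q (q ^ j)) \<longlonglongrightarrow> max_gf r q 0"
    by (rule isCont_tendsto_compose) (rule LIMSEQ_power_zero[OF assms(1)])
  also have "max_gf r q 0 = 1"
    unfolding max_gf_def powser_zero gapless_max_0[OF assms(2)] by simp
  finally show ?thesis .
qed

text \<open>By the functional equation at z = q^j, the normalised value \<open>X j\<close> does not
  depend on \<open>j\<close>. Its limit for large \<open>j\<close>, where \<open>max_gf\<close>
  tends to 1, identifies the constant.\<close>

lemma max_gf_power:
  fixes q :: "'a::{real_normed_field, banach}"
  assumes "norm q < 1" "r > 0"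
  shows "max_gf r q (q ^ j) =
    (\<Prod>k. 1 - q ^ Suc r * (q ^ Suc r) ^ k) / (\<Prod>k. 1 - q * q ^ k) *
      (qpoch q q j / qpoch (q ^ Suc r) (q ^ Suc r) j)"
proof -
  let ?Q = "q ^ Suc r"
  define X where "X j = max_gf r q (q ^ j) * (qpoch ?Q ?Q j / qpoch q q j)" for j
  have Q: "norm ?Q < 1"
    using norm_mult_power_less_one[OF assms(1,1), of r] by simp
  have ne: "qpoch q q m \<noteq> 0" "qpoch ?Q ?Q m \<noteq> 0" for m
    using qpoch_ne_zero[OF assms(1,1)] qpoch_ne_zero[OF Q Q] by blast+
  have "X (Suc j) = X j" for j
  proof -
    have qj: "norm (q ^ j) \<le> 1"
      unfolding norm_power using assms by (intro power_le_one) auto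
    have *: "(1 - q * q ^ j) * max_gf r q (q ^ j) = (1 - ?Q * ?Q ^ j) * max_gf r q (q ^ Suc j)"
    proof -
      have "(q ^ Suc j) ^ Suc r = ?Q ^ Suc j"
        unfolding power_mult [symmetric] by (rule arg_cong[of _ _ "power q"]) (rule mult.commute)
      also have "\<dots> = ?Q * ?Q ^ j"
        by (rule power_Suc)
      finally show ?thesis
        using max_gf_functional_equation[OF assms qj]
        unfolding power_Suc2 [symmetric] by (simp only: power_Suc2 mult.commute[of q "q ^ j"])
    qed
    have "1 - q * q ^ j \<noteq> 0"
      using norm_mult_power_less_one[OF assms(1,1)] by (rule one_minus_ne_zero)
    then have "max_gf r q (q ^ j) = (1 - ?Q * ?Q ^ j) * max_gf r q (q ^ Suc j) / (1 - q * q ^ j)"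
      using * by (simp add: nonzero_eq_divide_eq mult.commute)
    then show ?thesis
      unfolding X_def qpoch_Suc by (simp add: mult_ac)
  qed
  then have const: "X n = X 0" for n
    by (induction n) auto
  have "X \<longlonglongrightarrow> 1 * ((\<Prod>k. 1 - ?Q * ?Q ^ k) / (\<Prod>k. 1 - q * q ^ k))"
    unfolding X_def using assms Q
    by (intro tendsto_mult tendsto_divide max_gf_tendsto_1 qpoch_tendsto prodinf_qpoch_ne_zero)
  moreover have "X \<longlonglongrightarrow> X 0"
    by (intro tendsto_eventually always_eventually allI const)
  ultimately have "X 0 = 1 * ((\<Prod>k. 1 - ?Q * ?Q ^ k) / (\<Prod>k. 1 - q * q ^ k))"
    by (rule LIMSEQ_unique [rotated])
  then have "X j = (\<Prod>k. 1 - ?Q * ?Q ^ k) / (\<Prod>k. 1 - q * q ^ k)"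
    unfolding const[of j] by simp
  moreover have "max_gf r q (q ^ j) = X j * (qpoch q q j / qpoch ?Q ?Q j)"
    using ne[of j] unfolding X_def by simp
  ultimately show ?thesis
    by simp
qed

text \<open>The sum satisfies f(wq) = (1 - w) f(w). Iterating gives f(z q^n) = f(z) (z;q)_n, and
  continuity at 0 with f(0) = 1 yields the product.\<close>

lemma euler_series:
  assumes z: "norm z < 1" and q: "norm q < 1"
  shows "(\<lambda>j. z ^ j / qpoch q q j) sums (1 / qpoch_inf z q)"
proof -
  define f where "f w = (\<Sum>j. 1 / qpoch q q j * w ^ j)" for w
  obtain B where B: "\<And>n. norm (1 / qpoch q q n) \<le> B"
    using bounded_inverse_qpoch[OF q q] by blast
  have sm: "summable (\<lambda>j. 1 / qpoch q q j * w ^ j)" if "norm w < 1" for w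
  proof (rule summable_comparison_test')
    show "summable (\<lambda>j. B * norm w ^ j)"
      using that by (intro summable_mult summable_geometric) auto
    show "norm (1 / qpoch q q j * w ^ j) \<le> B * norm w ^ j" for j
      unfolding norm_mult norm_power using B by (intro mult_right_mono) auto
  qed
  have step: "f (w * q) = (1 - w) * f w" if w: "norm w < 1" for w
  proof -
    have wq: "norm (w * q) < 1"
      using norm_mult_power_less_one[OF w q, of 1] by simp
    \<comment> \<open>The difference carries the factor 1 - q^(j+1), which is the last factor of the
      denominator.\<close>
    have "1 / qpoch q q (Suc j) * w ^ Suc j - 1 / qpoch q q (Suc j) * (w * q) ^ Suc j =
        w * (1 / qpoch q q j * w ^ j)" for j
    proof -
      have "1 - q * q ^ j \<noteq> 0"
        using norm_mult_power_less_one[OF q q] by (rule one_minus_ne_zero)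
      moreover have "1 / qpoch q q (Suc j) * w ^ Suc j - 1 / qpoch q q (Suc j) * (w * q) ^ Suc j =
          w * w ^ j * (1 - q * q ^ j) / qpoch q q (Suc j)"
        by (simp add: power_mult_distrib algebra_simps diff_divide_distrib)
      ultimately show ?thesis
        unfolding qpoch_Suc by simp
    qed
    moreover have "(\<lambda>j. w * (1 / qpoch q q j * w ^ j)) sums (w * f w)"
      unfolding f_def by (intro sums_mult summable_sums sm w)
    ultimately have "(\<lambda>j. 1 / qpoch q q j * w ^ j - 1 / qpoch q q j * (w * q) ^ j) sums (w * f w)"
      using sums_Suc_iff[of "\<lambda>j. 1 / qpoch q q j * w ^ j - 1 / qpoch q q j * (w * q) ^ j"] by simp
    moreover have "(\<lambda>j. 1 / qpoch q q j * w ^ j - 1 / qpoch q q j * (w * q) ^ j) sums (f w - f (w * q))"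
      unfolding f_def by (intro sums_diff summable_sums sm w wq)
    ultimately have "f w - f (w * q) = w * f w"
      by (rule sums_unique2 [rotated])
    then show ?thesis by (simp add: algebra_simps)
  qed
  have "f (z * q ^ n) = f z * qpoch z q n" for n
  proof (induction n)
    case (Suc n)
    then show ?case
      using step[OF norm_mult_power_less_one[OF z q, of n]] by (simp add: qpoch_Suc mult_ac)
  qed simp
  then have "(\<lambda>n. f (z * q ^ n)) \<longlonglongrightarrow> f z * qpoch_inf z q"
    by (simp add: tendsto_mult_left qpoch_inf_tendsto q)
  moreover have "isCont f 0"
    unfolding f_def by (rule isCont_powser[of _ "1 / 2"]) (use sm[of "1 / 2"] in auto)
  then have "(\<lambda>n. f (z * q ^ n)) \<longlonglongrightarrow> f 0"
    by (rule isCont_tendsto_compose)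
      (use tendsto_mult_left[OF LIMSEQ_power_zero[OF q], of z] in simp)
  moreover have "f 0 = 1"
    unfolding f_def powser_zero by simp
  ultimately have "f z * qpoch_inf z q = 1"
    using LIMSEQ_unique by metis
  then have "f z = 1 / qpoch_inf z q"
    using qpoch_inf_ne_zero[OF z q] by (simp add: field_simps)
  then show ?thesis
    using summable_sums[OF sm[OF z]] unfolding f_def by simp
qed

subsection \<open>Summation over the mex\<close>

lemma parts_gf_gapless_all_complex:
  fixes q :: complex
  assumes "norm q < 1"
  shows "parts_gf q (gapless_all r N) =
    parts_gf q (gapless_bounded r N N) * (1 / qpoch_inf (q * q ^ N) q)"
proof -
  have "parts_gf q (gapless_all r N) * (qpoch q q N * qpoch_inf (q * q ^ N) q) =
      parts_gf q (gapless_bounded r N N) * qpoch q q N"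
    using parts_gf_gapless_all[OF assms, of r N] qpoch_inf_split[OF assms, of q N]
    unfolding qpoch_inf_def by simp
  moreover have "qpoch q q N \<noteq> 0"
    using qpoch_ne_zero[OF assms assms] by blast
  moreover have "qpoch_inf (q * q ^ N) q \<noteq> 0"
    using qpoch_inf_ne_zero[OF norm_mult_power_less_one[OF assms assms] assms] by blast
  ultimately show ?thesis
    by (simp add: field_simps)
qed

text \<open>The same absolutely convergent double series is summed in both orders: over
  \<open>j\<close> first it gives the left side, over \<open>N\<close> first the values of
  \<open>max_gf\<close> at q^j.\<close>

lemma gapless_all_sums:
  fixes q :: complex
  assumes q: "norm q < 1" and r: "r > 0"
  shows "(\<lambda>N. parts_gf q (gapless_all r N)) sums
    (qpoch_inf (q ^ Suc r) (q ^ Suc r) / qpoch_inf q q *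
      (\<Sum>m=1..r. 1 / qpoch_inf (q ^ m) (q ^ Suc r)))" (is "_ sums ?S")
proof -
  let ?Q = "q ^ Suc r"
  define C where "C N = parts_gf q (gapless_bounded r N N)" for N
  \<comment> \<open>Euler's expansion of \<open>1 / (q\<^bsup>N+1\<^esup>; q)\<^sub>\<infinity>\<close> turns the sum over \<open>N\<close> into a double series over \<open>(j, N)\<close>.\<close>
  define g where "g = (\<lambda>(j, N). C N * ((q * q ^ N) ^ j / qpoch q q j))"
  define h where "h j = qpoch_inf ?Q ?Q / qpoch_inf q q *
    (\<Sum>m=1..r. (q ^ m) ^ j / qpoch ?Q ?Q j)" for j
  obtain B where B: "\<And>n. norm (1 / qpoch q q n) \<le> B"
    using bounded_inverse_qpoch[OF q q] by blast
  have B0: "B \<ge> 0"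
    using B[of 0] by simp
  have Q: "norm ?Q < 1"
    using norm_mult_power_less_one[OF q q, of r] by simp
  have qj: "norm (q ^ j) \<le> 1" for j
    unfolding norm_power using q by (intro power_le_one) auto
  have sumC: "summable (\<lambda>N. norm (C N))"
    unfolding C_def by (rule summable_norm_gapless_bounded[OF q r])
  \<comment> \<open>The majorant B |q|^j |C N| separates the indices into a geometric and a
    convergent series.\<close>
  have abs: "(\<lambda>x. norm (g x)) summable_on UNIV \<times> UNIV"
  proof (rule summable_on_comparison_test)
    have "(\<lambda>(j, N). B * norm q ^ j * norm (C N)) summable_on UNIV \<times> UNIV"
    proof (rule summable_on_SigmaI)
      have "((\<lambda>N. norm (C N)) has_sum (\<Sum>N. norm (C N))) UNIV"
        using sumC by (intro norm_summable_imp_has_sum summable_sums) auto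
      then show "((\<lambda>N. case (j, N) of (j, N) \<Rightarrow> B * norm q ^ j * norm (C N)) has_sum
          B * norm q ^ j * (\<Sum>N. norm (C N))) UNIV" for j
        by (simp add: has_sum_cmult_right)
      show "(\<lambda>j. B * norm q ^ j * (\<Sum>N. norm (C N))) summable_on UNIV"
        using q B0 sumC
        by (subst summable_on_UNIV_nonneg_real_iff)
          (auto intro!: summable_mult summable_mult2 summable_geometric mult_nonneg_nonneg suminf_nonneg)
    qed (use B0 in auto)
    then show "(\<lambda>(j, N). B * norm q ^ j * norm (C N)) summable_on UNIV \<times> UNIV" .
    show "norm (g x) \<le> (case x of (j, N) \<Rightarrow> B * norm q ^ j * norm (C N))" for x
    proof (cases x)
      case (Pair j N)
      have "norm ((q * q ^ N) ^ j) \<le> norm q ^ j"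
        unfolding norm_power norm_mult
        using q by (intro power_mono) (auto simp: mult_left_le power_le_one)
      then have "norm (1 / qpoch q q j) * norm ((q * q ^ N) ^ j) \<le> B * norm q ^ j"
        using B B0 by (intro mult_mono) auto
      then have "norm ((q * q ^ N) ^ j / qpoch q q j) \<le> B * norm q ^ j"
        by (simp add: norm_divide)
      then have "norm (C N) * norm ((q * q ^ N) ^ j / qpoch q q j) \<le> norm (C N) * (B * norm q ^ j)"
        by (rule mult_left_mono) simp
      then show ?thesis
        unfolding g_def Pair prod.case norm_mult by (simp only: mult_ac)
    qed
  qed simp
  have pow: "(q * q ^ N) ^ j = q ^ j * (q ^ j) ^ N" for N j
    by (simp only: power_mult_distrib power_mult [symmetric] mult.commute[of N j])
  have rows: "((\<lambda>N. g (j, N)) has_sum h j) UNIV" for j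
  proof (rule norm_summable_imp_has_sum)
    have "(\<lambda>N. g (j, N)) = (\<lambda>N. q ^ j / qpoch q q j * (C N * (q ^ j) ^ N))"
    proof
      fix N
      show "g (j, N) = q ^ j / qpoch q q j * (C N * (q ^ j) ^ N)"
        using pow[of N j] by (simp add: g_def)
    qed
    moreover have "(\<lambda>N. q ^ j / qpoch q q j * (C N * (q ^ j) ^ N)) sums
        (q ^ j / qpoch q q j * ((\<Sum>i<r. (q ^ j) ^ i) * max_gf r q (q ^ j)))"
      unfolding C_def by (intro sums_mult gapless_bounded_sums q r qj)
    \<comment> \<open>The factor \<open>qpoch q q j\<close> in the value of \<open>max_gf\<close>
      cancels, and q^j (1 + q^j + ... + q^(j(r-1))) is the sum of q^(mj) over m = 1, ..., r.\<close>
    moreover have "q ^ j / qpoch q q j * ((\<Sum>i<r. (q ^ j) ^ i) * max_gf r q (q ^ j)) = h j"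
    proof -
      have "qpoch q q j \<noteq> 0"
        using qpoch_ne_zero[OF q q] by blast
      moreover have "(\<Sum>m=1..r. (q ^ m) ^ j) = q ^ j * (\<Sum>i<r. (q ^ j) ^ i)"
        by (simp add: sum.atLeast1_atMost_eq pow sum_distrib_left)
      ultimately show ?thesis
        unfolding h_def max_gf_power[OF q r] qpoch_inf_def sum_divide_distrib [symmetric]
        by simp
    qed
    ultimately show "(\<lambda>N. g (j, N)) sums h j" by simp
    show "summable (\<lambda>N. norm (g (j, N)))"
    proof (rule summable_on_imp_summable)
      have "(\<lambda>(j, N). norm (g (j, N))) summable_on UNIV \<times> UNIV"
        using abs by (simp add: case_prod_unfold)
      then show "(\<lambda>N. norm (g (j, N))) summable_on UNIV"
        by (rule summable_on_SigmaD1) simp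
    qed
  qed
  have "h sums ?S"
    unfolding h_def
  proof (intro sums_mult sums_sum euler_series Q)
    fix m assume "m \<in> {1..r}"
    then have "norm (q ^ m) = norm (q * q ^ (m - 1))"
      by (cases m) auto
    then show "norm (q ^ m) < 1"
      using norm_mult_power_less_one[OF q q, of "m - 1"] by simp
  qed
  moreover have "(g has_sum infsum g (UNIV \<times> UNIV)) (UNIV \<times> UNIV)"
    using abs_summable_summable[OF abs] by (rule has_sum_infsum)
  moreover have "(h has_sum infsum g (UNIV \<times> UNIV)) UNIV"
    using has_sum_SigmaD[OF calculation(2) rows] .
  ultimately have g: "(g has_sum ?S) (UNIV \<times> UNIV)"
    using has_sum_imp_sums sums_unique2 by metis
  have cols: "((\<lambda>j. g (j, N)) has_sum parts_gf q (gapless_all r N)) UNIV" for N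
  proof (rule norm_summable_imp_has_sum)
    have "(\<lambda>j. C N * ((q * q ^ N) ^ j / qpoch q q j)) sums (C N * (1 / qpoch_inf (q * q ^ N) q))"
      by (intro sums_mult euler_series norm_mult_power_less_one q)
    then show "(\<lambda>j. g (j, N)) sums parts_gf q (gapless_all r N)"
      by (simp add: g_def C_def parts_gf_gapless_all_complex[OF q])
    have "(\<lambda>(N, j). norm (g (j, N))) summable_on UNIV \<times> UNIV"
      using abs summable_on_swap[of "\<lambda>x. norm (g x)" UNIV UNIV] by simp
    then have "(\<lambda>j. norm (g (j, N))) summable_on UNIV"
      by (rule summable_on_SigmaD1) simp
    then show "summable (\<lambda>j. norm (g (j, N)))"
      by (rule summable_on_imp_summable)
  qed
  have "((\<lambda>(N, j). g (j, N)) has_sum ?S) (UNIV \<times> UNIV)"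
    using g by (rule has_sum_swap[THEN iffD1])
  then have "((\<lambda>N. parts_gf q (gapless_all r N)) has_sum ?S) UNIV"
    by (rule has_sum_SigmaD) (simp add: cols)
  then show ?thesis
    by (rule has_sum_imp_sums)
qed

text \<open>Since \<open>qpoch x x N\<close> is at most 1, these terms are at most those of
  \<open>C\<close> divided by the constant \<open>P\<close>. The real case justifies the exchange of
  sums over the mex.\<close>

lemma summable_gapless_all_real:
  fixes x :: real
  assumes "0 \<le> x" "x < 1" "r > 0"
  shows "summable (\<lambda>N. parts_gf x (gapless_all r N))"
proof -
  have x: "norm x < 1" using assms by simp
  define P where "P = (\<Prod>k. 1 - x * x ^ k)"
  have P: "P \<noteq> 0"
    unfolding P_def by (rule prodinf_qpoch_ne_zero[OF x x])
  show ?thesis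
  proof (rule summable_comparison_test')
    show "summable (\<lambda>N. norm (parts_gf x (gapless_bounded r N N)) / \<bar>P\<bar>)"
      by (intro summable_divide summable_norm_gapless_bounded x assms)
    fix N
    have "qpoch x x N \<le> 1"
      unfolding qpoch_def using assms norm_mult_power_less_one[OF x x]
      by (intro prod_le_1) (auto intro: less_imp_le)
    then have "norm (parts_gf x (gapless_all r N)) * \<bar>P\<bar> \<le> norm (parts_gf x (gapless_bounded r N N)) * 1"
      using parts_gf_gapless_all[OF x, of r N] qpoch_real_pos[OF assms(1,2), of N]
      unfolding P_def [symmetric] real_norm_def abs_mult [symmetric]
      by (simp add: abs_mult mult_left_le)
    then show "norm (parts_gf x (gapless_all r N)) \<le> norm (parts_gf x (gapless_bounded r N N)) / \<bar>P\<bar>"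
      using P by (simp add: field_simps)
  qed
qed

text \<open>The mex of \<open>\<pi>\<close> is the number of \<open>k < rc_mex r \<pi>\<close>, so
  the weighted sum counts pairs of \<open>k\<close> and \<open>\<pi>\<close>, which can also be
  grouped by \<open>k\<close>.\<close>

lemma rc_mex_has_sum:
  fixes q :: complex
  assumes q: "norm q < 1" and r: "r > 0"
    and S: "(\<lambda>k. parts_gf q (gapless_all r (k + r - 1))) sums S"
  shows "((\<lambda>\<pi>. of_nat (rc_mex r \<pi>) * q ^ sum_list \<pi>) has_sum S) all_parts"
proof -
  let ?U = "\<lambda>k. gapless_all r (k + r - 1)"
  let ?A = "Sigma UNIV ?U"
  have U: "?U k \<subseteq> all_parts" for k
    by (auto simp: gapless_all_def)
  have abs: "(\<lambda>x. norm (case x of (k, \<pi>) \<Rightarrow> q ^ sum_list \<pi>)) summable_on ?A"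
  proof -
    have "(\<lambda>(k, \<pi>). norm q ^ sum_list \<pi>) summable_on ?A"
    proof (rule summable_on_SigmaI)
      show "((\<lambda>\<pi>. case (k, \<pi>) of (k, \<pi>) \<Rightarrow> norm q ^ sum_list \<pi>) has_sum parts_gf (norm q) (?U k)) (?U k)" for k
        using parts_gf_has_sum[of "norm q", OF _ U] q by simp
      have "summable (\<lambda>k. parts_gf (norm q) (?U k))"
        using summable_iff_shift[of "\<lambda>N. parts_gf (norm q) (gapless_all r N)" "r - 1"]
          summable_gapless_all_real[of "norm q" r] q r by simp
      moreover have "parts_gf (norm q) A \<ge> 0" for A
        unfolding parts_gf_def by (intro infsum_nonneg) auto
      ultimately show "(\<lambda>k. parts_gf (norm q) (?U k)) summable_on UNIV"
        by (subst summable_on_UNIV_nonneg_real_iff) auto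
    qed auto
    then show ?thesis
      by (simp add: case_prod_unfold norm_power)
  qed
  have *: "((\<lambda>(k, \<pi>). q ^ sum_list \<pi>) has_sum (\<Sum>\<^sub>\<infinity>(k, \<pi>)\<in>?A. q ^ sum_list \<pi>)) ?A"
    using abs_summable_summable[OF abs] by (rule has_sum_infsum)
  then have "((\<lambda>k. parts_gf q (?U k)) has_sum (\<Sum>\<^sub>\<infinity>(k, \<pi>)\<in>?A. q ^ sum_list \<pi>)) UNIV"
  proof (rule has_sum_SigmaD)
    show "((\<lambda>\<pi>. case (k, \<pi>) of (k, \<pi>) \<Rightarrow> q ^ sum_list \<pi>) has_sum parts_gf q (?U k)) (?U k)" for k
      unfolding prod.case by (rule parts_gf_has_sum[OF q U])
  qed
  then have "(\<Sum>\<^sub>\<infinity>(k, \<pi>)\<in>?A. q ^ sum_list \<pi>) = S"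
    by (rule sums_unique2[OF has_sum_imp_sums S])
  with * have A: "((\<lambda>(k, \<pi>). q ^ sum_list \<pi>) has_sum S) ?A"
    by (rule subst [rotated])
  have "((\<lambda>(\<pi>, k). q ^ sum_list \<pi>) has_sum S) (Sigma all_parts (\<lambda>\<pi>. {..<rc_mex r \<pi>}))
      \<longleftrightarrow> ((\<lambda>(k, \<pi>). q ^ sum_list \<pi>) has_sum S) ?A"
    by (rule has_sum_reindex_bij_witness[of _ "\<lambda>(k, \<pi>). (\<pi>, k)" "\<lambda>(\<pi>, k). (k, \<pi>)"])
      (auto simp: less_rc_mex_iff[OF r] gapless_all_def)
  then have "((\<lambda>(\<pi>, k). q ^ sum_list \<pi>) has_sum S) (Sigma all_parts (\<lambda>\<pi>. {..<rc_mex r \<pi>}))"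
    using A by blast
  then show ?thesis
    by (rule has_sum_SigmaD) (simp add: has_sum_finite_iff)
qed

lemma sigma_rc_mex_sums:
  fixes q :: complex
  assumes "((\<lambda>\<pi>. of_nat (rc_mex r \<pi>) * q ^ sum_list \<pi>) has_sum S) all_parts"
  shows "(\<lambda>n. of_nat (sigma_rc_mex r n) * q ^ n) sums S"
proof (rule has_sum_imp_sums)
  let ?A = "Sigma UNIV partitions"
  have "bij_betw (\<lambda>\<pi>. (sum_list \<pi>, \<pi>)) all_parts ?A"
    by (rule bij_betwI[of _ _ _ snd]) (auto simp: all_parts_def partitions_def)
  then have "((\<lambda>(n, \<pi>). of_nat (rc_mex r \<pi>) * q ^ sum_list \<pi>) has_sum S) ?A"
    using assms has_sum_reindex_bij_betw[of "\<lambda>\<pi>. (sum_list \<pi>, \<pi>)" all_parts ?A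
        "\<lambda>(n, \<pi>). of_nat (rc_mex r \<pi>) * q ^ sum_list \<pi>" S]
    by simp
  then show "((\<lambda>n. of_nat (sigma_rc_mex r n) * q ^ n) has_sum S) UNIV"
  proof (rule has_sum_SigmaD)
    fix n
    have "(\<Sum>\<pi>\<in>partitions n. of_nat (rc_mex r \<pi>) * q ^ sum_list \<pi>) = of_nat (sigma_rc_mex r n) * q ^ n"
      unfolding sigma_rc_mex_def of_nat_sum sum_distrib_right
      by (intro sum.cong) (auto simp: partitions_def)
    then show "((\<lambda>\<pi>. case (n, \<pi>) of (n, \<pi>) \<Rightarrow> of_nat (rc_mex r \<pi>) * q ^ sum_list \<pi>) has_sum
        of_nat (sigma_rc_mex r n) * q ^ n) (partitions n)"
      using has_sum_finite[OF finite_partitions, of "\<lambda>\<pi>. of_nat (rc_mex r \<pi>) * q ^ sum_list \<pi>" n]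
      by simp
  qed
qed

theorem theorem2p8:
  fixes r :: nat and q :: complex
  assumes "r > 0" and "norm q < 1"
  shows "(\<lambda>n. of_nat (sigma_rc_mex r n) * q ^ n) sums
    (- ((of_nat r - 1) / qpoch_inf q q)
      + qpoch_inf (q ^ (r + 1)) (q ^ (r + 1)) / qpoch_inf q q
        * (\<Sum>m = 1..r. 1 / qpoch_inf (q ^ m) (q ^ (r + 1))))"
proof -
  let ?S = "qpoch_inf (q ^ Suc r) (q ^ Suc r) / qpoch_inf q q *
    (\<Sum>m=1..r. 1 / qpoch_inf (q ^ m) (q ^ Suc r))"
  have "parts_gf q all_parts = 1 / qpoch_inf q q"
    using parts_gf_all_parts[OF assms(2)] qpoch_inf_ne_zero[OF assms(2,2)]
    by (simp add: qpoch_inf_def field_simps)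
  \<comment> \<open>For \<open>N < r - 1\<close> no window fits, so each of these terms is 1 /
    (q;q)_inf. The mex sum starts at \<open>N = r - 1\<close>; removing them gives the negative
    term.\<close>
  then have "(\<Sum>N<r - 1. parts_gf q (gapless_all r N)) = (of_nat r - 1) / qpoch_inf q q"
    using assms(1) by (simp add: gapless_all_eq_all_parts of_nat_diff)
  then have "(\<lambda>k. parts_gf q (gapless_all r (k + (r - 1)))) sums (?S - (of_nat r - 1) / qpoch_inf q q)"
    using sums_split_initial_segment[OF gapless_all_sums[OF assms(2,1)], of "r - 1"] by simp
  then have "(\<lambda>k. parts_gf q (gapless_all r (k + r - 1))) sums (?S - (of_nat r - 1) / qpoch_inf q q)"
    using assms(1) by simp
  then have "(\<lambda>n. of_nat (sigma_rc_mex r n) * q ^ n) sums (?S - (of_nat r - 1) / qpoch_inf q q)"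
    by (intro sigma_rc_mex_sums rc_mex_has_sum assms)
  then show ?thesis
    by simp
qed

end
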